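(* Let $f:\mathbb{R}^n\to\mathbb{R}$ be convex ($\mu_f=0$) and differentiable with $L_f$-Lipschitz gradient, let $g:\mathbb{R}^m\to(-\infty,+\infty]$ be proper, closed and strongly convex with parameter $\mu_g>0$, and let $A\in\mathbb{R}^{m\times n}$. Assume $2L_f+\tau\|A\|^2>0$ and run LDPD (defined in the context) with $$\theta_t=\frac{2}{t+1},\qquad \alpha_t=\frac{t-1}{t},\qquad \tau=\frac{3}{\mu_g},\qquad \tau_t=\frac{\tau}{t},\qquad \eta_t=\frac{t}{2L_f+\tau\|A\|^2}.$$ For $k\ge1$ let $E_{k+1}=L(\bar x_{k+1},y)-L(x,\bar y_{k+1})$, where $$\bar x_{k+1}=\frac{\sum_{t=1}^k t\,x_{t+1}}{\sum_{t=1}^k t},\qquad \bar y_{k+1}=\frac{\sum_{t=1}^k t\,y_{t+1}}{\sum_{t=1}^k t}$$ (these coincide with the LDPD aggregation points). Then for all $k\ge1$, $x\in\mathbb{R}^n$ and $y\in Y$, $$E_{k+1}\le\frac{(2L_f+\tau\|A\|^2)\|x-x_1\|^2}{k(k+1)}+\frac{\|y-y_1\|^2}{k(k+1)\tau}.$$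
   Context: Saddle point problem: $\min_x\max_y L(x,y)$ with $L(x,y)=f(x)+\langle Ax,y\rangle-g(y)$. Norms are Euclidean, and $\|A\|$ is the operator norm. Put $Y=\operatorname{dom} g=\{y\in\mathbb{R}^m: g(y)<+\infty\}$. A function $h$ is strongly convex with parameter $\mu\ge0$ if $h-\frac{\mu}{2}\|\cdot\|^2$ is convex. LDPD (linearized method): given $x_1\in\mathbb{R}^n$, $y_1\in Y$, parameters $\theta_t\in(0,1]$, $\alpha_t\in\mathbb{R}$, $\tau_t>0$, $\eta_t>0$, set $\bar x_1=x_1$, $\bar y_1=y_1$, $\hat y_1=y_1$, and for $t=1,2,\dots$ compute - $\hat x_t=(1-\theta_t)\bar x_t+\theta_t x_t$, - $x_{t+1}=\arg\min_{x}\|x-[x_t-\eta_t(\nabla f(\hat x_t)+A^T\hat y_t)]\|^2$, - $\bar x_{t+1}=(1-\theta_t)\bar x_t+\theta_t x_{t+1}$, - $y_{t+1}=\arg\min_y\left\{\frac{1}{2\tau_t}\|y-(y_t+\tau_tAx_{t+1})\|^2+g(y)\right\}$, - $\hat y_{t+1}=y_{t+1}+\alpha_{t+1}(y_{t+1}-y_t)$, - $\bar y_{t+1}=(1-\theta_t)\bar y_t+\theta_t y_{t+1}$. *)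

theory Defs
  imports "HOL-Analysis.Analysis"
begin

text \<open>Convex analysis of extended-real-valued functions. The library's \<open>epigraph\<close>
  and \<open>convex_on\<close> are restricted to real-valued functions.\<close>

definition epi :: "('a \<Rightarrow> ereal) \<Rightarrow> ('a \<times> real) set" where
  "epi h = {(x, r). h x \<le> ereal r}"

definition convex_fun :: "('a::real_vector \<Rightarrow> ereal) \<Rightarrow> bool" where
  "convex_fun h \<longleftrightarrow> convex (epi h)"

definition closed_fun :: "('a::topological_space \<Rightarrow> ereal) \<Rightarrow> bool" where
  "closed_fun h \<longleftrightarrow> closed (epi h)"

definition proper_fun :: "('a \<Rightarrow> ereal) \<Rightarrow> bool" where
  "proper_fun h \<longleftrightarrow> (\<forall>x. h x \<noteq> -\<infinity>) \<and> (\<exists>x. h x \<noteq> \<infinity>)"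

definition strongly_convex_fun :: "real \<Rightarrow> ('a::real_normed_vector \<Rightarrow> ereal) \<Rightarrow> bool" where
  "strongly_convex_fun \<mu> h \<longleftrightarrow> convex_fun (\<lambda>x. h x - ereal (\<mu> / 2 * (norm x)\<^sup>2))"

definition edom :: "('a \<Rightarrow> ereal) \<Rightarrow> 'a set" where
  "edom h = {x. h x < \<infinity>}"

definition saddle ::
  "(real^'n \<Rightarrow> real) \<Rightarrow> real^'n^'m \<Rightarrow> (real^'m \<Rightarrow> ereal) \<Rightarrow> real^'n \<Rightarrow> real^'m \<Rightarrow> ereal" where
  "saddle f A g x y = ereal (f x + (A *v x) \<bullet> y) - g y"

text \<open>\<open>ldpd gradf A g \<theta> \<alpha> \<tau> \<eta> x xh xb y yh yb\<close>: the sequences form a run of the linearized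
  method with parameter sequences \<open>\<theta>\<close>, \<open>\<alpha>\<close>, \<open>\<tau>\<close>, \<open>\<eta>\<close>, where \<open>gradf\<close> is the gradient of the
  smooth term, \<open>xh\<close> and \<open>yh\<close> are the hatted sequences and \<open>xb\<close> and \<open>yb\<close> the barred ones.
  Indexing starts at 1; values at index 0 are unconstrained. The starting point
  is \<open>(x 1, y 1)\<close>.\<close>

definition ldpd ::
  "(real^'n \<Rightarrow> real^'n) \<Rightarrow> real^'n^'m \<Rightarrow> (real^'m \<Rightarrow> ereal) \<Rightarrow>
   (nat \<Rightarrow> real) \<Rightarrow> (nat \<Rightarrow> real) \<Rightarrow> (nat \<Rightarrow> real) \<Rightarrow> (nat \<Rightarrow> real) \<Rightarrow>
   (nat \<Rightarrow> real^'n) \<Rightarrow> (nat \<Rightarrow> real^'n) \<Rightarrow> (nat \<Rightarrow> real^'n) \<Rightarrow>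
   (nat \<Rightarrow> real^'m) \<Rightarrow> (nat \<Rightarrow> real^'m) \<Rightarrow> (nat \<Rightarrow> real^'m) \<Rightarrow> bool" where
  "ldpd gradf A g \<theta> \<alpha> \<tau> \<eta> x xh xb y yh yb \<longleftrightarrow>
     (\<forall>t\<ge>1. 0 < \<theta> t \<and> \<theta> t \<le> 1 \<and> 0 < \<tau> t \<and> 0 < \<eta> t) \<and>
     y 1 \<in> edom g \<and> xb 1 = x 1 \<and> yb 1 = y 1 \<and> yh 1 = y 1 \<and>
     (\<forall>t\<ge>1.
        xh t = (1 - \<theta> t) *\<^sub>R xb t + \<theta> t *\<^sub>R x t \<and>
        is_arg_min
          (\<lambda>z. (norm (z - (x t - \<eta> t *\<^sub>R (gradf (xh t) + transpose A *v yh t))))\<^sup>2)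
          (\<lambda>_. True) (x (t + 1)) \<and>
        xb (t + 1) = (1 - \<theta> t) *\<^sub>R xb t + \<theta> t *\<^sub>R x (t + 1) \<and>
        is_arg_min
          (\<lambda>z. ereal (1 / (2 * \<tau> t) * (norm (z - (y t + \<tau> t *\<^sub>R (A *v x (t + 1)))))\<^sup>2) + g z)
          (\<lambda>_. True) (y (t + 1)) \<and>
        yh (t + 1) = y (t + 1) + \<alpha> (t + 1) *\<^sub>R (y (t + 1) - y t) \<and>
        yb (t + 1) = (1 - \<theta> t) *\<^sub>R yb t + \<theta> t *\<^sub>R y (t + 1))"

definition weighted_avg :: "(nat \<Rightarrow> 'a::real_vector) \<Rightarrow> nat \<Rightarrow> 'a" where
  "weighted_avg z k = (\<Sum>t=1..k. real t *\<^sub>R z (t + 1)) /\<^sub>R (\<Sum>t=1..k. real t)"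

end

theory Submission
  imports Defs
begin

text \<open>Write \<open>M = 2 L\<^sub>f + \<tau> \<parallel>A\<parallel>\<^sup>2\<close> and let \<open>E\<^sub>t\<close> be the primal--dual gap of the averages \<open>(xb t, yb t)\<close>
  against a fixed pair \<open>(u, v)\<close>. The bound follows from a potential argument: the increment
  \<open>t (t + 1) / 2 E\<^sub>t\<^sub>+\<^sub>1 - (t - 1) t / 2 E\<^sub>t\<close> is at most a sum of differences that telescope over \<open>t\<close>, and
  dividing the telescoped sum by \<open>k (k + 1) / 2\<close> gives the rate.

  Two inequalities control an iteration. The first (\<open>linearized_primal_step\<close>) is the estimate for an
  accelerated gradient step: \<open>f\<close> lies below its quadratic model at the extrapolated point \<open>xh\<close> and above
  its tangents there, so moving the average towards the new iterate costs the multiple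
  \<open>L\<^sub>f \<theta>\<^sup>2 / 2\<close> of \<open>\<parallel>x\<^sub>t\<^sub>+\<^sub>1 - x\<^sub>t\<parallel>\<^sup>2\<close>. The second (\<open>prox_three_point\<close>) is the optimality of the dual
  proximal step, where strong convexity of \<open>g\<close> yields an additional \<open>\<mu>\<^sub>g / 2 \<parallel>v - y\<^sub>t\<^sub>+\<^sub>1\<parallel>\<^sup>2\<close>.

  The dual step already sees the new primal iterate, whereas the primal step sees only the
  extrapolation \<open>yh\<close>. After adding up, the bilinear terms reduce to the mismatch
  \<open>(A (x\<^sub>t\<^sub>+\<^sub>1 - u)) \<bullet> (y\<^sub>t\<^sub>+\<^sub>1 - yh t)\<close>. The extrapolation weight \<open>(t - 1) / t\<close> makes it telescope up to an error
  \<open>(t - 1) (A (x\<^sub>t\<^sub>+\<^sub>1 - x\<^sub>t)) \<bullet> (y\<^sub>t - y\<^sub>t\<^sub>-\<^sub>1)\<close>, which is split by Young's inequality; the term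
  \<open>\<tau> \<parallel>A\<parallel>\<^sup>2\<close> in \<open>M\<close>, hence in the primal stepsize, is there to absorb the primal half of it. The dual
  stepsize \<open>\<tau> / t\<close> decreases, so the squared dual distances carry the growing weight \<open>t\<^sup>2 / (2 \<tau>)\<close>, and
  the strong convexity of \<open>g\<close> compensates for that growth once \<open>\<tau> \<mu>\<^sub>g = 3\<close>. These cancellations
  are carried out in \<open>gap_step\<close>.\<close>

section \<open>Smooth convex functions\<close>

lemma GDERIV_along_line:
  fixes f :: "'a::real_inner \<Rightarrow> real"
  assumes "\<And>u. GDERIV f u :> gradf u"
  shows "((\<lambda>s. f (a + s *\<^sub>R d)) has_real_derivative gradf (a + s *\<^sub>R d) \<bullet> d) (at s)"
proof -
  have "(f has_derivative (\<lambda>h. h \<bullet> gradf (a + s *\<^sub>R d))) (at (a + s *\<^sub>R d))"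
    using assms by (simp add: gderiv_def)
  moreover have "((\<lambda>s. a + s *\<^sub>R d) has_derivative (\<lambda>h. h *\<^sub>R d)) (at s)"
    by (auto intro!: derivative_eq_intros)
  ultimately have "((\<lambda>s. f (a + s *\<^sub>R d)) has_derivative (\<lambda>h. (h *\<^sub>R d) \<bullet> gradf (a + s *\<^sub>R d))) (at s)"
    by (rule has_derivative_compose[rotated])
  moreover have "(\<lambda>h. (h *\<^sub>R d) \<bullet> gradf (a + s *\<^sub>R d)) = (*) (gradf (a + s *\<^sub>R d) \<bullet> d)"
    by (auto simp: inner_commute)
  ultimately show ?thesis
    by (simp add: has_field_derivative_def)
qed

lemma convex_above_gradient_tangent:
  fixes f :: "'a::real_inner \<Rightarrow> real"
  assumes "convex_on UNIV f" and "\<And>u. GDERIV f u :> gradf u"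
  shows "f a + gradf a \<bullet> (b - a) \<le> f b"
proof -
  let ?\<phi> = "\<lambda>s. f (a + s *\<^sub>R (b - a))"
  have "convex_on UNIV ?\<phi>"
  proof (rule convex_onI)
    fix t r s :: real assume "0 < t" "t < 1"
    have "a + ((1 - t) *\<^sub>R r + t *\<^sub>R s) *\<^sub>R (b - a)
        = (1 - t) *\<^sub>R (a + r *\<^sub>R (b - a)) + t *\<^sub>R (a + s *\<^sub>R (b - a))"
      by (simp add: algebra_simps)
    then show "?\<phi> ((1 - t) *\<^sub>R r + t *\<^sub>R s) \<le> (1 - t) * ?\<phi> r + t * ?\<phi> s"
      using convex_onD[OF assms(1), of t] \<open>0 < t\<close> \<open>t < 1\<close> by simp
  qed simp
  moreover have "(?\<phi> has_real_derivative gradf a \<bullet> (b - a)) (at 0)"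
    using GDERIV_along_line[where s = 0, OF assms(2)] by simp
  ultimately have "?\<phi> 1 - ?\<phi> 0 \<ge> (gradf a \<bullet> (b - a)) * (1 - 0)"
    by (intro convex_on_imp_above_tangent[where A = UNIV]) auto
  then show ?thesis by simp
qed

text \<open>Subtracting the quadratic model from \<open>f\<close> along the segment from \<open>a\<close> to \<open>b\<close> leaves a function
  whose derivative \<open>(gradf (a + s d) - gradf a) \<bullet> d - L s \<parallel>d\<parallel>\<^sup>2\<close> is nonpositive, by Cauchy--Schwarz
  and the Lipschitz bound.\<close>

lemma lipschitz_gradient_upper_model:
  fixes f :: "'a::real_inner \<Rightarrow> real"
  assumes "\<And>u. GDERIV f u :> gradf u" and "L-lipschitz_on UNIV gradf"
  shows "f b \<le> f a + gradf a \<bullet> (b - a) + L / 2 * (norm (b - a))\<^sup>2"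
proof -
  define d where "d = b - a"
  let ?\<psi> = "\<lambda>s. f (a + s *\<^sub>R d) - s * (gradf a \<bullet> d) - L / 2 * s\<^sup>2 * (norm d)\<^sup>2"
  have "?\<psi> 1 \<le> ?\<psi> 0"
  proof (rule DERIV_nonpos_imp_nonincreasing[where f = ?\<psi> and a = 0 and b = 1])
    fix s :: real assume "0 \<le> s" "s \<le> 1"
    have "(?\<psi> has_real_derivative
        gradf (a + s *\<^sub>R d) \<bullet> d - gradf a \<bullet> d - L * s * (norm d)\<^sup>2) (at s)"
      by (auto intro!: derivative_eq_intros GDERIV_along_line assms(1))
    moreover have "(gradf (a + s *\<^sub>R d) - gradf a) \<bullet> d \<le> (L * s * norm d) * norm d"
    proof -
      have "norm (gradf (a + s *\<^sub>R d) - gradf a) \<le> L * s * norm d"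
        using lipschitz_onD[OF assms(2), of "a + s *\<^sub>R d" a] \<open>0 \<le> s\<close> by (simp add: dist_norm)
      then show ?thesis
        by (meson norm_cauchy_schwarz mult_right_mono norm_ge_zero order_trans)
    qed
    ultimately show "\<exists>D. (?\<psi> has_real_derivative D) (at s) \<and> D \<le> 0"
      by (intro exI conjI) (auto simp: inner_diff_left power2_eq_square)
  qed simp
  then show ?thesis by (simp add: d_def)
qed

text \<open>The smooth part of one accelerated step: the upper model at \<open>xh\<close> is evaluated at the new
  average \<open>xb'\<close>, which differs from \<open>xh\<close> by \<open>\<theta> (x' - x)\<close>. Since \<open>xb' = (1 - \<theta>) xb + \<theta> x'\<close>, its
  affine part splits into tangents below \<open>f xb\<close> and \<open>f u\<close> and the term \<open>\<theta> gradf xh \<bullet> (x' - u)\<close>,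
  which the definition of \<open>x'\<close> turns into a difference of squares.\<close>

lemma linearized_primal_step:
  fixes f :: "'a::real_inner \<Rightarrow> real"
  assumes f: "convex_on UNIV f" "\<And>u. GDERIV f u :> gradf u" "L-lipschitz_on UNIV gradf"
    and \<theta>: "0 \<le> \<theta>" "\<theta> \<le> 1" and \<eta>: "0 < \<eta>"
    and xh: "xh = (1 - \<theta>) *\<^sub>R xb + \<theta> *\<^sub>R x"
    and x': "x' = x - \<eta> *\<^sub>R (gradf xh + c)"
    and xb': "xb' = (1 - \<theta>) *\<^sub>R xb + \<theta> *\<^sub>R x'"
  shows "f xb' \<le> (1 - \<theta>) * f xb + \<theta> * f u - \<theta> * (c \<bullet> (x' - u))
      + \<theta> / (2 * \<eta>) * ((norm (x - u))\<^sup>2 - (norm (x' - u))\<^sup>2 - (norm (x' - x))\<^sup>2)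
      + L * \<theta>\<^sup>2 / 2 * (norm (x' - x))\<^sup>2"
proof -
  let ?p = "gradf xh"
  have diff: "xb' - xh = \<theta> *\<^sub>R (x' - x)"
    by (simp add: xb' xh algebra_simps)
  have "f xb' \<le> f xh + ?p \<bullet> (xb' - xh) + L * \<theta>\<^sup>2 / 2 * (norm (x' - x))\<^sup>2"
    using lipschitz_gradient_upper_model[OF f(2,3), of xb' xh]
    by (simp add: diff power_mult_distrib mult_ac)
  also have "f xh + ?p \<bullet> (xb' - xh)
      = (1 - \<theta>) * (f xh + ?p \<bullet> (xb - xh)) + \<theta> * (f xh + ?p \<bullet> (u - xh)) + \<theta> * (?p \<bullet> (x' - u))"
    by (simp add: xb' inner_simps algebra_simps)
  also have "\<dots> \<le> (1 - \<theta>) * f xb + \<theta> * f u + \<theta> * (?p \<bullet> (x' - u))"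
    using \<theta> by (intro add_mono mult_left_mono convex_above_gradient_tangent f) auto
  finally have model: "f xb' \<le> (1 - \<theta>) * f xb + \<theta> * f u + \<theta> * (?p \<bullet> (x' - u))
      + L * \<theta>\<^sup>2 / 2 * (norm (x' - x))\<^sup>2"
    by simp
  have inner_step: "?p \<bullet> (x' - u) = - (c \<bullet> (x' - u))
      + 1 / (2 * \<eta>) * ((norm (x - u))\<^sup>2 - (norm (x' - u))\<^sup>2 - (norm (x' - x))\<^sup>2)"
  proof -
    have "\<eta> *\<^sub>R (?p + c) = x - x'" by (simp add: x')
    then have "\<eta> * ((?p + c) \<bullet> (x' - u)) = (x - x') \<bullet> (x' - u)"
      by (metis inner_scaleR_left)
    also have "\<dots> = ((norm (x - u))\<^sup>2 - (norm (x' - u))\<^sup>2 - (norm (x' - x))\<^sup>2) / 2"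
      by (simp add: power2_norm_eq_inner inner_simps inner_commute field_simps)
    finally show ?thesis using \<eta> by (simp add: inner_simps field_simps)
  qed
  have "\<theta> * (?p \<bullet> (x' - u)) = - (\<theta> * (c \<bullet> (x' - u)))
      + \<theta> / (2 * \<eta>) * ((norm (x - u))\<^sup>2 - (norm (x' - u))\<^sup>2 - (norm (x' - x))\<^sup>2)"
    unfolding inner_step by (simp add: right_diff_distrib)
  with model show ?thesis by linarith
qed


section \<open>Strongly convex extended-real-valued functions\<close>

lemma norm_square_convex_combination:
  fixes a b :: "'a::real_inner"
  shows "(norm ((1 - s) *\<^sub>R a + s *\<^sub>R b))\<^sup>2
    = (1 - s) * (norm a)\<^sup>2 + s * (norm b)\<^sup>2 - s * (1 - s) * (norm (a - b))\<^sup>2"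
  by (simp add: power2_norm_eq_inner inner_simps inner_commute) (simp add: power2_eq_square algebra_simps)

lemma proper_fun_ereal_real:
  assumes "proper_fun g" "a \<in> edom g"
  shows "ereal (real_of_ereal (g a)) = g a"
  using assms by (auto simp: proper_fun_def edom_def ereal_real)

text \<open>Convexity of the epigraph of \<open>g - \<mu> / 2 \<parallel>\<cdot>\<parallel>\<^sup>2\<close> gives the plain convexity inequality for that
  difference. Adding the quadratic back produces the last term, by the identity for the squared norm
  of a convex combination.\<close>

lemma strongly_convex_fun_combination:
  fixes g :: "'a::real_inner \<Rightarrow> ereal"
  assumes g: "proper_fun g" "strongly_convex_fun \<mu> g"
    and ab: "a \<in> edom g" "b \<in> edom g" and s: "0 \<le> s" "s \<le> 1"
  shows "(1 - s) *\<^sub>R a + s *\<^sub>R b \<in> edom g" (is "?c \<in> _")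
    and "real_of_ereal (g ((1 - s) *\<^sub>R a + s *\<^sub>R b))
      \<le> (1 - s) * real_of_ereal (g a) + s * real_of_ereal (g b)
        - \<mu> / 2 * s * (1 - s) * (norm (a - b))\<^sup>2"
proof -
  let ?G = "\<lambda>z. real_of_ereal (g z)"
  let ?H = "\<lambda>z. g z - ereal (\<mu> / 2 * (norm z)\<^sup>2)"
  define r where "r z = ?G z - \<mu> / 2 * (norm z)\<^sup>2" for z
  have "(z, r z) \<in> epi ?H" if "z \<in> edom g" for z
    using proper_fun_ereal_real[OF g(1) that] by (cases "g z") (auto simp: epi_def r_def)
  moreover have "convex (epi ?H)"
    using g(2) by (simp add: strongly_convex_fun_def convex_fun_def)
  ultimately have "(1 - s) *\<^sub>R (a, r a) + s *\<^sub>R (b, r b) \<in> epi ?H"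
    using ab s by (intro convexD) auto
  then have "?H ?c \<le> ereal ((1 - s) * r a + s * r b)"
    by (simp add: epi_def)
  then have le: "g ?c \<le> ereal ((1 - s) * r a + s * r b + \<mu> / 2 * (norm ?c)\<^sup>2)"
    by (cases "g ?c") auto
  then show dom: "?c \<in> edom g"
    by (auto simp: edom_def)
  have "?G ?c \<le> (1 - s) * r a + s * r b + \<mu> / 2 * (norm ?c)\<^sup>2"
    using le proper_fun_ereal_real[OF g(1) dom] by (metis ereal_less_eq(3))
  then show "?G ?c \<le> (1 - s) * ?G a + s * ?G b - \<mu> / 2 * s * (1 - s) * (norm (a - b))\<^sup>2"
    unfolding norm_square_convex_combination r_def
    by (simp add: algebra_simps add_divide_distrib diff_divide_distrib)
qed

lemma prox_in_edom:
  assumes "is_arg_min (\<lambda>z. ereal (q z) + g z) (\<lambda>_. True) y'" "a \<in> edom g"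
  shows "y' \<in> edom g"
proof (rule ccontr)
  assume "y' \<notin> edom g"
  then have "ereal (q a) + g a < ereal (q y') + g y'"
    using assms(2) by (cases "g a") (auto simp: edom_def)
  then show False
    using assms(1) by (auto simp: is_arg_min_def)
qed

text \<open>The proximal objective is strongly convex with parameter \<open>\<mu> + 1 / \<tau>\<close>, so it exceeds its
  minimum at \<open>y'\<close> by at least half that parameter times the squared distance to \<open>y'\<close>.\<close>

lemma prox_three_point:
  fixes g :: "'a::real_inner \<Rightarrow> ereal"
  assumes g: "proper_fun g" "strongly_convex_fun \<mu> g" and "0 < \<tau>"
    and min: "is_arg_min (\<lambda>z. ereal (1 / (2 * \<tau>) * (norm (z - (y + \<tau> *\<^sub>R w)))\<^sup>2) + g z)
        (\<lambda>_. True) y'"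
    and v: "v \<in> edom g"
  shows "real_of_ereal (g y') - real_of_ereal (g v) \<le> w \<bullet> (y' - v)
      + 1 / (2 * \<tau>) * ((norm (v - y))\<^sup>2 - (norm (y' - y))\<^sup>2)
      - (1 / (2 * \<tau>) + \<mu> / 2) * (norm (v - y'))\<^sup>2"
proof -
  define p where "p = y + \<tau> *\<^sub>R w"
  define h where "h z = 1 / (2 * \<tau>) * (norm (z - p))\<^sup>2 + real_of_ereal (g z)" for z
  define K where "K = (1 / (2 * \<tau>) + \<mu> / 2) * (norm (y' - v))\<^sup>2"
  have y': "y' \<in> edom g"
    by (rule prox_in_edom[OF min v])
  have h_min: "h y' \<le> h z" if "z \<in> edom g" for z
  proof -
    have "ereal (1 / (2 * \<tau>) * (norm (z' - p))\<^sup>2) + g z' = ereal (h z')" if "z' \<in> edom g" for z'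
      using proper_fun_ereal_real[OF g(1) that] by (cases "g z'") (auto simp: h_def)
    moreover have "\<not> ereal (1 / (2 * \<tau>) * (norm (z - p))\<^sup>2) + g z
        < ereal (1 / (2 * \<tau>) * (norm (y' - p))\<^sup>2) + g y'"
      using min unfolding is_arg_min_def p_def by blast
    ultimately show ?thesis
      using that y' by simp
  qed
  \<comment> \<open>Compare \<open>y'\<close> with the point at fraction \<open>1 - s\<close> of the way to \<open>v\<close>, then let \<open>s\<close> tend to 1.\<close>
  have "s * K \<le> h v - h y'" if s: "0 < s" "s < 1" for s
  proof -
    let ?c = "(1 - (1 - s)) *\<^sub>R y' + (1 - s) *\<^sub>R v"
    have "h ?c \<le> s * h y' + (1 - s) * h v - s * (1 - s) * K"
    proof -
      have "?c - p = (1 - (1 - s)) *\<^sub>R (y' - p) + (1 - s) *\<^sub>R (v - p)"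
        by (simp add: algebra_simps)
      then have dist: "(norm (?c - p))\<^sup>2
          = s * (norm (y' - p))\<^sup>2 + (1 - s) * (norm (v - p))\<^sup>2 - (1 - s) * s * (norm (y' - v))\<^sup>2"
        using norm_square_convex_combination[of "1 - s" "y' - p" "v - p"] by simp
      have "real_of_ereal (g ?c) \<le> s * real_of_ereal (g y') + (1 - s) * real_of_ereal (g v)
          - \<mu> / 2 * (1 - s) * s * (norm (y' - v))\<^sup>2"
        using strongly_convex_fun_combination(2)[OF g y' v, of "1 - s"] s by simp
      then show ?thesis
        unfolding h_def K_def dist
        by (simp add: algebra_simps add_divide_distrib diff_divide_distrib)
    qed
    moreover have "h y' \<le> h ?c"
      using s by (intro h_min strongly_convex_fun_combination(1)[OF g y' v]) auto
    ultimately have "0 \<le> (1 - s) * (h v - h y' - s * K)"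
      by (simp add: algebra_simps)
    then show ?thesis
      using s by (simp add: zero_le_mult_iff)
  qed
  then have "K \<le> h v - h y'"
    by (rule field_le_mult_one_interval)
  moreover have "1 / (2 * \<tau>) * (norm (v - p))\<^sup>2 - 1 / (2 * \<tau>) * (norm (y' - p))\<^sup>2
      = w \<bullet> (y' - v) + 1 / (2 * \<tau>) * ((norm (v - y))\<^sup>2 - (norm (y' - y))\<^sup>2)"
    using \<open>0 < \<tau>\<close> unfolding p_def
    by (simp add: power2_norm_eq_inner inner_simps inner_commute field_simps)
  ultimately show ?thesis
    unfolding h_def K_def by (simp add: norm_minus_commute algebra_simps)
qed


section \<open>Weighted averages\<close>

text \<open>Multiplied by \<open>k (k + 1) / 2 = 1 + \<dots> + k\<close>, the recursion reads: add \<open>k z (k + 1)\<close> to the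
  previous value. At \<open>t = 1\<close> the coefficient of \<open>zb 1\<close> is 0, so the starting value is forgotten.\<close>

lemma weighted_avg_recursion:
  fixes z zb :: "nat \<Rightarrow> 'a::real_vector"
  assumes rec: "\<And>t. t \<ge> 1 \<Longrightarrow>
      zb (t + 1) = (1 - 2 / (real t + 1)) *\<^sub>R zb t + (2 / (real t + 1)) *\<^sub>R z (t + 1)"
    and "k \<ge> 1"
  shows "zb (k + 1) = weighted_avg z k"
proof -
  have sum_id: "(\<Sum>t=1..k. real t) = real k * (real k + 1) / 2" for k
    by (induction k) (auto simp: field_simps)
  have "(real k * (real k + 1) / 2) *\<^sub>R zb (k + 1) = (\<Sum>t=1..k. real t *\<^sub>R z (t + 1))" for k
  proof (induction k)
    case 0
    then show ?case by simp
  next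
    case (Suc k)
    let ?S = "real (Suc k) * (real (Suc k) + 1) / 2"
    have "?S *\<^sub>R zb (Suc k + 1)
        = (?S * (1 - 2 / (real (Suc k) + 1))) *\<^sub>R zb (k + 1)
          + (?S * (2 / (real (Suc k) + 1))) *\<^sub>R z (Suc k + 1)"
      using rec[of "Suc k"] by (simp add: scaleR_add_right)
    also have "?S * (1 - 2 / (real (Suc k) + 1)) = real k * (real k + 1) / 2"
      by (simp add: field_simps)
    also have "?S * (2 / (real (Suc k) + 1)) = real (Suc k)"
      by (simp add: field_simps)
    finally show ?case
      using Suc.IH by simp
  qed
  then have "weighted_avg z k
      = inverse (real k * (real k + 1) / 2) *\<^sub>R (real k * (real k + 1) / 2) *\<^sub>R zb (k + 1)"
    unfolding weighted_avg_def sum_id by simp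
  then show ?thesis
    using \<open>k \<ge> 1\<close> by simp
qed


section \<open>The primal--dual gap along the iteration\<close>

text \<open>A real-valued form of the difference of two values of \<open>saddle\<close>. With \<open>G\<close> the real part of \<open>g\<close>, it
  agrees with that difference when \<open>v\<close> and \<open>Y\<close> lie in the domain of \<open>g\<close>; outside it, \<open>real_of_ereal\<close>
  replaces \<open>\<infinity>\<close> by 0.\<close>

definition gap ::
  "(real^'n \<Rightarrow> real) \<Rightarrow> real^'n^'m \<Rightarrow> (real^'m \<Rightarrow> real) \<Rightarrow>
   real^'n \<Rightarrow> real^'m \<Rightarrow> real^'n \<Rightarrow> real^'m \<Rightarrow> real" where
  "gap f A G u v X Y = (f X + (A *v X) \<bullet> v - G v) - (f u + (A *v u) \<bullet> Y - G Y)"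

lemma young_matrix:
  fixes A :: "real^'n^'m"
  assumes "0 < \<tau>"
  shows "c * ((A *v d) \<bullet> e)
    \<le> \<tau> * (onorm ((*v) A))\<^sup>2 / 2 * (norm d)\<^sup>2 + c\<^sup>2 / (2 * \<tau>) * (norm e)\<^sup>2"
proof -
  have "0 \<le> (norm (\<tau> *\<^sub>R (A *v d) - c *\<^sub>R e))\<^sup>2" by simp
  also have "\<dots> = \<tau>\<^sup>2 * (norm (A *v d))\<^sup>2 - 2 * \<tau> * c * ((A *v d) \<bullet> e) + c\<^sup>2 * (norm e)\<^sup>2"
    by (simp add: power2_norm_eq_inner inner_simps inner_commute) (simp add: power2_eq_square algebra_simps)
  finally have "c * ((A *v d) \<bullet> e) \<le> \<tau> / 2 * (norm (A *v d))\<^sup>2 + c\<^sup>2 / (2 * \<tau>) * (norm e)\<^sup>2"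
    using assms by (simp add: field_simps power2_eq_square)
  also have "(norm (A *v d))\<^sup>2 \<le> (onorm ((*v) A) * norm d)\<^sup>2"
    by (intro power_mono onorm) (auto simp: matrix_vector_mul_bounded_linear)
  finally show ?thesis
    using assms by (simp add: power_mult_distrib mult_ac)
qed

text \<open>One iteration, with \<open>t\<close> the iteration number and \<open>yp\<close> the dual iterate before \<open>y\<close>. Multiplied by
  \<open>t (t + 1) / 2\<close>, the recursion of the averages makes the gap telescope, because
  \<open>t (t + 1) / 2 \<cdot> \<theta> = t\<close> and \<open>t (t + 1) / 2 \<cdot> (1 - \<theta>) = (t - 1) t / 2\<close>. All bilinear terms combine into
  \<open>t (A (x' - u)) \<bullet> (y' - yh)\<close>, and the choice of \<open>yh\<close> splits this into a telescoping pair and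
  \<open>(t - 1) (A (x' - x)) \<bullet> (y - yp)\<close>, which Young's inequality charges to \<open>\<parallel>x' - x\<parallel>\<^sup>2\<close> in this
  iteration and to \<open>\<parallel>y - yp\<parallel>\<^sup>2\<close> in the previous one. The primal stepsize leaves exactly enough of
  \<open>\<parallel>x' - x\<parallel>\<^sup>2\<close>. Strong convexity of \<open>g\<close> pays for the growth from \<open>t\<^sup>2\<close> to \<open>(t + 1)\<^sup>2\<close> in front of
  the squared dual distances: \<open>t\<^sup>2 + \<tau> \<mu> t \<ge> (t + 1)\<^sup>2\<close> when \<open>\<tau> \<mu> = 3\<close> and \<open>t \<ge> 1\<close>.\<close>

lemma gap_step:
  fixes f :: "real^'n \<Rightarrow> real" and A :: "real^'n^'m" and g :: "real^'m \<Rightarrow> ereal" and t :: real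
  defines "G \<equiv> \<lambda>z. real_of_ereal (g z)"
  assumes f: "convex_on UNIV f" "\<And>u. GDERIV f u :> gradf u" "L-lipschitz_on UNIV gradf"
    and g: "proper_fun g" "strongly_convex_fun \<mu> g"
    and \<tau>: "0 < \<tau>" "\<tau> * \<mu> = 3"
    and M: "M = 2 * L + \<tau> * (onorm ((*v) A))\<^sup>2" "0 < M"
    and t: "1 \<le> t" and \<theta>: "\<theta> = 2 / (t + 1)"
    and dom: "v \<in> edom g" "yb \<in> edom g"
    and xh: "xh = (1 - \<theta>) *\<^sub>R xb + \<theta> *\<^sub>R x"
    and yh: "yh = y + ((t - 1) / t) *\<^sub>R (y - yp)"
    and x': "x' = x - (t / M) *\<^sub>R (gradf xh + transpose A *v yh)"
    and xb': "xb' = (1 - \<theta>) *\<^sub>R xb + \<theta> *\<^sub>R x'"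
    and y': "is_arg_min
        (\<lambda>z. ereal (1 / (2 * (\<tau> / t)) * (norm (z - (y + (\<tau> / t) *\<^sub>R (A *v x'))))\<^sup>2) + g z)
        (\<lambda>_. True) y'"
    and yb': "yb' = (1 - \<theta>) *\<^sub>R yb + \<theta> *\<^sub>R y'"
  shows "t * (t + 1) / 2 * gap f A G u v xb' yb'
    \<le> (t - 1) * t / 2 * gap f A G u v xb yb
      + M / 2 * ((norm (x - u))\<^sup>2 - (norm (x' - u))\<^sup>2)
      + t\<^sup>2 / (2 * \<tau>) * (norm (v - y))\<^sup>2 - (t + 1)\<^sup>2 / (2 * \<tau>) * (norm (v - y'))\<^sup>2
      + (t - 1)\<^sup>2 / (2 * \<tau>) * (norm (y - yp))\<^sup>2 - t\<^sup>2 / (2 * \<tau>) * (norm (y' - y))\<^sup>2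
      + t * ((A *v (x' - u)) \<bullet> (y' - y)) - (t - 1) * ((A *v (x - u)) \<bullet> (y - yp))"
proof -
  define S where "S = t * (t + 1) / 2"
  have S: "0 \<le> S" "S * \<theta> = t" "S * (1 - \<theta>) = (t - 1) * t / 2"
    using t by (simp_all add: S_def \<theta> field_simps)
  have \<theta>01: "0 \<le> \<theta>" "\<theta> \<le> 1"
    using t by (simp_all add: \<theta>)
  define dx where "dx = (norm (x' - x))\<^sup>2"
  define Px where "Px = (norm (x - u))\<^sup>2 - (norm (x' - u))\<^sup>2 - dx"
  define Bh where "Bh = (A *v (x' - u)) \<bullet> yh"
  have L: "0 \<le> L"
    using f(3) by (rule lipschitz_on_nonneg)

  have primal: "S * f xb' \<le> (t - 1) * t / 2 * f xb + t * f u - t * Bh + M / 2 * Px + L * dx"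
  proof -
    have "f xb' \<le> (1 - \<theta>) * f xb + \<theta> * f u - \<theta> * ((transpose A *v yh) \<bullet> (x' - u))
        + \<theta> / (2 * (t / M)) * Px + L * \<theta>\<^sup>2 / 2 * dx"
      unfolding Px_def dx_def
      by (rule linearized_primal_step[OF f \<theta>01 _ xh x' xb']) (use t M in simp)
    also have "(transpose A *v yh) \<bullet> (x' - u) = Bh"
      unfolding Bh_def by (simp add: dot_lmul_matrix inner_commute flip: vector_transpose_matrix)
    finally have "S * f xb' \<le> S * ((1 - \<theta>) * f xb + \<theta> * f u - \<theta> * Bh
        + \<theta> / (2 * (t / M)) * Px + L * \<theta>\<^sup>2 / 2 * dx)"
      using S(1) by (rule mult_left_mono)
    also have "\<dots> = S * (1 - \<theta>) * f xb + S * \<theta> * f u - S * \<theta> * Bh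
        + S * \<theta> * M / (2 * t) * Px + S * \<theta> * \<theta> * L / 2 * dx"
      by (simp add: algebra_simps power2_eq_square)
    also have "\<dots> = (t - 1) * t / 2 * f xb + t * f u - t * Bh + M / 2 * Px + (t * \<theta> / 2) * (L * dx)"
      unfolding S using t by simp
    also have "(t * \<theta> / 2) * (L * dx) \<le> 1 * (L * dx)"
      by (rule mult_right_mono) (use t L in \<open>auto simp: \<theta> dx_def field_simps\<close>)
    finally show ?thesis by simp
  qed

  have y'_dom: "y' \<in> edom g"
    by (rule prox_in_edom[OF y' dom(1)])
  have "G yb' \<le> (1 - \<theta>) * G yb + \<theta> * G y' - \<mu> / 2 * \<theta> * (1 - \<theta>) * (norm (yb - y'))\<^sup>2"
    unfolding G_def yb' by (rule strongly_convex_fun_combination(2)[OF g dom(2) y'_dom \<theta>01])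
  moreover have "0 \<le> \<mu>"
    using \<tau> by (metis less_eq_real_def linorder_not_less mult_nonneg_nonpos zero_less_numeral)
  ultimately have "G yb' \<le> (1 - \<theta>) * G yb + \<theta> * G y'"
    using \<theta>01 by (smt (verit) mult_nonneg_nonneg zero_le_power2 divide_nonneg_nonneg)
  then have "S * G yb' \<le> S * ((1 - \<theta>) * G yb + \<theta> * G y')"
    using S(1) by (rule mult_left_mono)
  also have "\<dots> = (t - 1) * t / 2 * G yb + t * G y'"
    using S(2,3) by (metis distrib_left mult.assoc)
  finally have avg: "S * G yb' \<le> (t - 1) * t / 2 * G yb + t * G y'" .

  have dual: "t * (G y' - G v) \<le> t * ((A *v x') \<bullet> (y' - v))
      + t\<^sup>2 / (2 * \<tau>) * (norm (v - y))\<^sup>2 - t\<^sup>2 / (2 * \<tau>) * (norm (y' - y))\<^sup>2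
      - (t + 1)\<^sup>2 / (2 * \<tau>) * (norm (v - y'))\<^sup>2"
  proof -
    have "G y' - G v \<le> (A *v x') \<bullet> (y' - v)
        + 1 / (2 * (\<tau> / t)) * ((norm (v - y))\<^sup>2 - (norm (y' - y))\<^sup>2)
        - (1 / (2 * (\<tau> / t)) + \<mu> / 2) * (norm (v - y'))\<^sup>2"
      unfolding G_def by (rule prox_three_point[OF g _ y' dom(1)]) (use t \<tau> in simp)
    then have "t * (G y' - G v) \<le> t * ((A *v x') \<bullet> (y' - v)
        + 1 / (2 * (\<tau> / t)) * ((norm (v - y))\<^sup>2 - (norm (y' - y))\<^sup>2)
        - (1 / (2 * (\<tau> / t)) + \<mu> / 2) * (norm (v - y'))\<^sup>2)"
      by (rule mult_left_mono) (use t in simp)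
    also have "\<dots> = t * ((A *v x') \<bullet> (y' - v))
        + t\<^sup>2 / (2 * \<tau>) * (norm (v - y))\<^sup>2 - t\<^sup>2 / (2 * \<tau>) * (norm (y' - y))\<^sup>2
        - (t\<^sup>2 / (2 * \<tau>) + t * \<mu> / 2) * (norm (v - y'))\<^sup>2"
      by (simp add: algebra_simps power2_eq_square)
    finally have *: "t * (G y' - G v) \<le> \<dots>" .
    have \<mu>: "\<mu> = 3 / \<tau>" using \<tau> by (simp add: field_simps)
    have "(t + 1)\<^sup>2 / (2 * \<tau>) \<le> t\<^sup>2 / (2 * \<tau>) + t * \<mu> / 2"
      unfolding \<mu> using \<tau>(1) t by (simp add: field_simps power2_eq_square)
    then have "(t + 1)\<^sup>2 / (2 * \<tau>) * (norm (v - y'))\<^sup>2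
        \<le> (t\<^sup>2 / (2 * \<tau>) + t * \<mu> / 2) * (norm (v - y'))\<^sup>2"
      by (rule mult_right_mono) simp
    with * show ?thesis by linarith
  qed

  have "S * gap f A G u v xb' yb'
      = S * f xb' + S * G yb' - S * (f u + G v) + S * ((A *v xb') \<bullet> v) - S * ((A *v u) \<bullet> yb')"
    by (simp add: gap_def algebra_simps)
  also have "S * ((A *v xb') \<bullet> v) = (t - 1) * t / 2 * ((A *v xb) \<bullet> v) + t * ((A *v x') \<bullet> v)"
    unfolding xb' by (simp add: matrix_vector_right_distrib matrix_vector_mult_scaleR inner_simps
        distrib_left S flip: mult.assoc)
  also have "S * ((A *v u) \<bullet> yb') = (t - 1) * t / 2 * ((A *v u) \<bullet> yb) + t * ((A *v u) \<bullet> y')"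
    unfolding yb' by (simp add: inner_simps distrib_left S flip: mult.assoc)
  also have "S * (f u + G v) = (t - 1) * t / 2 * (f u + G v) + t * (f u + G v)"
    by (simp add: S_def field_simps)
  finally have expand: "S * gap f A G u v xb' yb' = S * f xb' + S * G yb'
      - ((t - 1) * t / 2 * (f u + G v) + t * (f u + G v))
      + ((t - 1) * t / 2 * ((A *v xb) \<bullet> v) + t * ((A *v x') \<bullet> v))
      - ((t - 1) * t / 2 * ((A *v u) \<bullet> yb) + t * ((A *v u) \<bullet> y'))" .
  have old: "(t - 1) * t / 2 * gap f A G u v xb yb
      = (t - 1) * t / 2 * f xb + (t - 1) * t / 2 * G yb - (t - 1) * t / 2 * (f u + G v)
        + (t - 1) * t / 2 * ((A *v xb) \<bullet> v) - (t - 1) * t / 2 * ((A *v u) \<bullet> yb)"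
    unfolding gap_def by (simp only: distrib_left right_diff_distrib)

  have bilinear: "- t * Bh + t * ((A *v x') \<bullet> v) - t * ((A *v u) \<bullet> y') + t * ((A *v x') \<bullet> (y' - v))
      = t * ((A *v (x' - u)) \<bullet> (y' - y)) - (t - 1) * ((A *v (x - u)) \<bullet> (y - yp))
        - (t - 1) * ((A *v (x' - x)) \<bullet> (y - yp))"
  proof -
    have "t *\<^sub>R yh = t *\<^sub>R y + (t - 1) *\<^sub>R (y - yp)"
      using t by (simp add: yh scaleR_add_right)
    then have "t * Bh = (A *v (x' - u)) \<bullet> (t *\<^sub>R y + (t - 1) *\<^sub>R (y - yp))"
      unfolding Bh_def by (metis inner_scaleR_right)
    then have "t * Bh = t * ((A *v (x' - u)) \<bullet> y) + (t - 1) * ((A *v (x' - u)) \<bullet> (y - yp))"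
      by (simp only: inner_add_right inner_scaleR_right)
    then show ?thesis
      by (simp add: matrix_vector_mult_diff_distrib inner_simps algebra_simps)
  qed
  have spare: "M / 2 - L = \<tau> * (onorm ((*v) A))\<^sup>2 / 2"
    by (simp add: M(1) field_simps)
  have young: "- (t - 1) * ((A *v (x' - x)) \<bullet> (y - yp))
      \<le> (M / 2 - L) * dx + (t - 1)\<^sup>2 / (2 * \<tau>) * (norm (y - yp))\<^sup>2"
    using young_matrix[OF \<tau>(1), of "- (t - 1)" A "x' - x" "y - yp"]
    by (simp add: spare dx_def power2_commute)
  have Px: "M / 2 * Px + L * dx
      = M / 2 * ((norm (x - u))\<^sup>2 - (norm (x' - u))\<^sup>2) - (M / 2 - L) * dx"
    by (simp add: Px_def algebra_simps)
  have "t * (f u + G v) = t * f u + t * G v" "t * (G y' - G v) = t * G y' - t * G v"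
    by (simp_all add: algebra_simps)
  with primal avg dual expand old bilinear young Px show ?thesis
    unfolding S_def[symmetric] by linarith
qed

text \<open>Summing the iterations leaves \<open>k (A (x\<^sub>k\<^sub>+\<^sub>1 - u)) \<bullet> (y\<^sub>k\<^sub>+\<^sub>1 - y\<^sub>k)\<close>. The negative
  squares left over from the telescoping absorb it, since \<open>\<tau> \<parallel>A\<parallel>\<^sup>2 \<le> M\<close>. The induction starts at
  \<open>k = 0\<close>, where \<open>y 0\<close> enters with coefficient 0 and the potential equals its initial bound.\<close>

theorem theorem3p2:
  fixes f :: "real^'n \<Rightarrow> real" and gradf :: "real^'n \<Rightarrow> real^'n"
    and g :: "real^'m \<Rightarrow> ereal" and A :: "real^'n^'m"
    and L\<^sub>f \<mu>\<^sub>g \<tau> :: real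
    and x xh xb :: "nat \<Rightarrow> real^'n" and y yh yb :: "nat \<Rightarrow> real^'m"
  assumes "convex_on UNIV f"
    and "\<And>u. GDERIV f u :> gradf u"
    and "L\<^sub>f-lipschitz_on UNIV gradf"
    and "proper_fun g" and "closed_fun g"
    and "0 < \<mu>\<^sub>g" and "strongly_convex_fun \<mu>\<^sub>g g"
    and "\<tau> = 3 / \<mu>\<^sub>g"
    and "2 * L\<^sub>f + \<tau> * (onorm ((*v) A))\<^sup>2 > 0"
    and "ldpd gradf A g
           (\<lambda>t. 2 / (real t + 1)) (\<lambda>t. (real t - 1) / real t)
           (\<lambda>t. \<tau> / real t) (\<lambda>t. real t / (2 * L\<^sub>f + \<tau> * (onorm ((*v) A))\<^sup>2))
           x xh xb y yh yb"
  shows "\<forall>k\<ge>1.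
           xb (k + 1) = weighted_avg x k \<and> yb (k + 1) = weighted_avg y k \<and>
           (\<forall>u. \<forall>v \<in> edom g.
              saddle f A g (weighted_avg x k) v - saddle f A g u (weighted_avg y k)
              \<le> ereal ((2 * L\<^sub>f + \<tau> * (onorm ((*v) A))\<^sup>2) * (norm (u - x 1))\<^sup>2
                          / (real k * (real k + 1))
                        + (norm (v - y 1))\<^sup>2 / (real k * (real k + 1) * \<tau>)))"
proof (intro allI impI)
  fix k :: nat assume k: "k \<ge> 1"
  note f = assms(1,2,3)
  note g = assms(4,7)
  define M where "M = 2 * L\<^sub>f + \<tau> * (onorm ((*v) A))\<^sup>2"
  define G where "G = (\<lambda>z. real_of_ereal (g z))"
  have M: "0 < M" using assms(9) by (simp add: M_def)
  have \<tau>: "0 < \<tau>" "\<tau> * \<mu>\<^sub>g = 3" using assms(6,8) by auto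
  note run = assms(10)[unfolded ldpd_def M_def[symmetric]]
  have init: "y 1 \<in> edom g" "yb 1 = y 1" "yh 1 = y 1"
    using run by simp_all
  have xh: "xh t = (1 - 2 / (real t + 1)) *\<^sub>R xb t + (2 / (real t + 1)) *\<^sub>R x t"
    and x_min: "is_arg_min
        (\<lambda>z. (norm (z - (x t - (real t / M) *\<^sub>R (gradf (xh t) + transpose A *v yh t))))\<^sup>2)
        (\<lambda>_. True) (x (t + 1))"
    and xb: "xb (t + 1) = (1 - 2 / (real t + 1)) *\<^sub>R xb t + (2 / (real t + 1)) *\<^sub>R x (t + 1)"
    and y_min: "is_arg_min
        (\<lambda>z. ereal (1 / (2 * (\<tau> / real t)) * (norm (z - (y t + (\<tau> / real t) *\<^sub>R (A *v x (t + 1)))))\<^sup>2)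
          + g z) (\<lambda>_. True) (y (t + 1))"
    and yh_Suc: "yh (t + 1) = y (t + 1) + ((real (t + 1) - 1) / real (t + 1)) *\<^sub>R (y (t + 1) - y t)"
    and yb: "yb (t + 1) = (1 - 2 / (real t + 1)) *\<^sub>R yb t + (2 / (real t + 1)) *\<^sub>R y (t + 1)"
    if "t \<ge> 1" for t
    using run that by blast+
  have x_step: "x (t + 1) = x t - (real t / M) *\<^sub>R (gradf (xh t) + transpose A *v yh t)"
    (is "_ = ?p") if "t \<ge> 1" for t
  proof -
    \<comment> \<open>The minimand is 0 at \<open>?p\<close>, so it is 0 at its minimizer.\<close>
    have "\<not> (norm (?p - ?p))\<^sup>2 < (norm (x (t + 1) - ?p))\<^sup>2"
      using x_min[OF that] unfolding is_arg_min_def by blast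
    then show ?thesis by simp
  qed
  \<comment> \<open>For \<open>k = 0\<close> the weight is 0 and the equation is the initialization \<open>yh 1 = y 1\<close>.\<close>
  have yh: "yh (k + 1) = y (k + 1) + ((real (k + 1) - 1) / real (k + 1)) *\<^sub>R (y (k + 1) - y k)" for k
    using yh_Suc[of k] init(3) by (cases "k = 0") auto
  have y_dom: "y (k + 1) \<in> edom g" for k
    using prox_in_edom[OF y_min init(1), of k] init(1) by (cases "k = 0") auto
  have yb_dom: "yb (k + 1) \<in> edom g" for k
  proof (induction k)
    case 0
    then show ?case using init by simp
  next
    case (Suc k)
    have "(1 - 2 / (real (k + 1) + 1)) *\<^sub>R yb (k + 1) + (2 / (real (k + 1) + 1)) *\<^sub>R y (Suc k + 1)
        \<in> edom g"
      by (rule strongly_convex_fun_combination(1)[OF g Suc.IH y_dom]) auto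
    then show ?case
      using yb[of "k + 1"] by simp
  qed

  have xb_avg: "xb (k + 1) = weighted_avg x k"
    using xb k by (intro weighted_avg_recursion) auto
  have yb_avg: "yb (k + 1) = weighted_avg y k"
    using yb k by (intro weighted_avg_recursion) auto

  have bound: "saddle f A g (xb (k + 1)) v - saddle f A g u (yb (k + 1))
      \<le> ereal (M * (norm (u - x 1))\<^sup>2 / (real k * (real k + 1))
          + (norm (v - y 1))\<^sup>2 / (real k * (real k + 1) * \<tau>))" if v: "v \<in> edom g" for u v
  proof -
    let ?E = "\<lambda>j. gap f A G u v (xb j) (yb j)"
    let ?B = "M / 2 * (norm (x 1 - u))\<^sup>2 + 1 / (2 * \<tau>) * (norm (v - y 1))\<^sup>2"
    have potential: "real j * (real j + 1) / 2 * ?E (j + 1)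
        \<le> ?B - M / 2 * (norm (x (j + 1) - u))\<^sup>2
          - (real j + 1)\<^sup>2 / (2 * \<tau>) * (norm (v - y (j + 1)))\<^sup>2
          - (real j)\<^sup>2 / (2 * \<tau>) * (norm (y (j + 1) - y j))\<^sup>2
          + real j * ((A *v (x (j + 1) - u)) \<bullet> (y (j + 1) - y j))" for j
    proof (induction j)
      case 0
      then show ?case by simp
    next
      case (Suc j)
      have one: "1 \<le> real (j + 1)" and ge: "j + 1 \<ge> 1" by auto
      have "real (j + 1) * (real (j + 1) + 1) / 2 * ?E (j + 1 + 1)
          \<le> (real (j + 1) - 1) * real (j + 1) / 2 * ?E (j + 1)
            + M / 2 * ((norm (x (j + 1) - u))\<^sup>2 - (norm (x (j + 1 + 1) - u))\<^sup>2)
            + (real (j + 1))\<^sup>2 / (2 * \<tau>) * (norm (v - y (j + 1)))\<^sup>2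
            - (real (j + 1) + 1)\<^sup>2 / (2 * \<tau>) * (norm (v - y (j + 1 + 1)))\<^sup>2
            + (real (j + 1) - 1)\<^sup>2 / (2 * \<tau>) * (norm (y (j + 1) - y j))\<^sup>2
            - (real (j + 1))\<^sup>2 / (2 * \<tau>) * (norm (y (j + 1 + 1) - y (j + 1)))\<^sup>2
            + real (j + 1) * ((A *v (x (j + 1 + 1) - u)) \<bullet> (y (j + 1 + 1) - y (j + 1)))
            - (real (j + 1) - 1) * ((A *v (x (j + 1) - u)) \<bullet> (y (j + 1) - y j))"
        unfolding G_def
        by (rule gap_step[OF f g \<tau> M_def M one refl v yb_dom xh[OF ge] yh x_step[OF ge] xb[OF ge]
              y_min[OF ge] yb[OF ge]])
      with Suc.IH show ?case
        by (simp add: algebra_simps)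
    qed
    have "real k * ((A *v (x (k + 1) - u)) \<bullet> (y (k + 1) - y k))
        \<le> \<tau> * (onorm ((*v) A))\<^sup>2 / 2 * (norm (x (k + 1) - u))\<^sup>2
          + (real k)\<^sup>2 / (2 * \<tau>) * (norm (y (k + 1) - y k))\<^sup>2"
      by (rule young_matrix[OF \<tau>(1)])
    also have "\<tau> * (onorm ((*v) A))\<^sup>2 / 2 * (norm (x (k + 1) - u))\<^sup>2
        \<le> M / 2 * (norm (x (k + 1) - u))\<^sup>2"
      using lipschitz_on_nonneg[OF f(3)] by (intro mult_right_mono) (auto simp: M_def)
    finally have "real k * (real k + 1) / 2 * ?E (k + 1)
        \<le> ?B - (real k + 1)\<^sup>2 / (2 * \<tau>) * (norm (v - y (k + 1)))\<^sup>2"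
      using potential[of k] by linarith
    also have "\<dots> \<le> ?B"
      using \<tau>(1) by simp
    finally have "?E (k + 1) \<le> ?B / (real k * (real k + 1) / 2)"
      using k by (simp add: pos_le_divide_eq mult.commute)
    also have "\<dots> = M * (norm (u - x 1))\<^sup>2 / (real k * (real k + 1))
          + (norm (v - y 1))\<^sup>2 / (real k * (real k + 1) * \<tau>)"
      using \<tau>(1) by (simp add: norm_minus_commute[of u] add_divide_distrib mult.commute)
    finally have real_bound: "?E (k + 1) \<le> \<dots>" .
    have "saddle f A g (xb (k + 1)) v - saddle f A g u (yb (k + 1)) = ereal (?E (k + 1))"
      using proper_fun_ereal_real[OF g(1) v] proper_fun_ereal_real[OF g(1) yb_dom[of k]]
      by (cases "g v"; cases "g (yb (k + 1))") (auto simp: saddle_def gap_def G_def)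
    then show ?thesis
      using real_bound by simp
  qed
  show "xb (k + 1) = weighted_avg x k \<and> yb (k + 1) = weighted_avg y k \<and>
           (\<forall>u. \<forall>v \<in> edom g.
              saddle f A g (weighted_avg x k) v - saddle f A g u (weighted_avg y k)
              \<le> ereal ((2 * L\<^sub>f + \<tau> * (onorm ((*v) A))\<^sup>2) * (norm (u - x 1))\<^sup>2
                          / (real k * (real k + 1))
                        + (norm (v - y 1))\<^sup>2 / (real k * (real k + 1) * \<tau>)))"
    using bound xb_avg yb_avg unfolding M_def by simp
qed

end
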